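(* Let $(\delta_n)_{n\ge0}$ be a strictly decreasing sequence of positive reals converging to $0$ such that $\sum_n\delta_n=\infty$. Then there exist Sturmian subshifts $\Xi$ for which, $\Xi$ being equipped with the metric $d$ defined by $(\delta_n)_n$, the metric $\overline{d}_s=\sup_\tau d_s^\tau$ is not continuous (on $\Xi\times\Xi$); moreover, for these subshifts there exists even a single choice function $\tau$ for which $d_s^\tau$ is not continuous.
   Context: Sturmian subshifts. Let $\theta\in(0,1)$ be irrational and $E_0\subset\mathbb R^2$ a line parallel to $(1,\theta)$ not meeting $\mathbb Z^2$. The points of $(E_0+[0,1]^2)\cap\mathbb Z^2$, ordered along the direction $(1,\theta)$, form a staircase in which consecutive points differ by $(1,0)$ or $(0,1)$; writing $a$ for a step $(1,0)$ and $b$ for a step $(0,1)$ gives a bi-infinite word in $\{a,b\}$. Its set of finite words $\mathcal L$ (including the empty word) depends only on $\theta$, and the Sturmian subshift $\Xi$ associated with $\theta$ is the set of one-sided infinite sequences $\xi=\xi_1\xi_2\cdots$ all of whose finite subwords lie in $\mathcal L$. Metric. For $\xi\ne\eta$ in $\Xi$, $d(\xi,\eta)=\delta_n$ where $n$ is the length of the longest common prefix of $\xi$ and $\eta$, and $d(\xi,\xi)=0$. Continuity is with respect to the topology of $d$ (the product topology). Choice functions. A choice function $\tau$ is given by choosing, for each $w\in\mathcal L$, a letter $a_w$ with $wa_w\in\mathcal L$; $\tau(w)\in\Xi$ is the infinite sequence obtained from $w$ by recursively appending the chosen letters. Spectral distance. Let $E$ be the set of ordered pairs $e=(u,v)$ of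 distinct words of $\mathcal L$ of equal length $n+1\ge1$ having the same prefix of length $n$; the length of such an edge is $l(e)=\delta_n$. On $\ell^2(E)$ let $\pi_\tau(f)\psi(u,v)=f(\tau(u))\psi(u,v)$ for $f\in C(\Xi)$, and $D\psi(u,v)=l(u,v)^{-1}\psi(v,u)$. The spectral distance is $d_s^\tau(x,y)=\sup\{|f(x)-f(y)|: f\in C(\Xi),\ \|[D,\pi_\tau(f)]\|\le 1\}\in[0,\infty]$; the condition $\|[D,\pi_\tau(f)]\|\le1$ means $|f(\tau(u))-f(\tau(v))|\le l(u,v)$ for all $(u,v)\in E$. $d_s^\tau$ and $\overline d_s$ may take the value $+\infty$; continuous means being a continuous real-valued function. *)

theory Defs
  imports "HOL-Analysis.Analysis"
begin

text \<open>The step \<open>(1,0)\<close> is coded by \<open>Horiz\<close> (the letter a), the step \<open>(0,1)\<close> by \<open>Vert\<close> (the letter b).\<close>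

datatype letter = Horiz | Vert

fun letter_step :: "letter \<Rightarrow> real \<times> real" where
  "letter_step Horiz = (1, 0)"
| "letter_step Vert = (0, 1)"

definition sturmian_line :: "real \<Rightarrow> (real \<times> real) set \<Rightarrow> bool" where
  "sturmian_line \<theta> E0 \<longleftrightarrow>
     (\<exists>q. E0 = {q + t *\<^sub>R (1, \<theta>) | t. True}) \<and> E0 \<inter> (\<int> \<times> \<int>) = {}"

definition staircase :: "(real \<times> real) set \<Rightarrow> (real \<times> real) set" where
  "staircase E0 = {e + z | e z. e \<in> E0 \<and> z \<in> {0..1} \<times> {0..1}} \<inter> (\<int> \<times> \<int>)"

definition consecutive :: "real \<Rightarrow> (real \<times> real) set \<Rightarrow> real \<times> real \<Rightarrow> real \<times> real \<Rightarrow> bool" where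
  "consecutive \<theta> S p q \<longleftrightarrow>
     p \<in> S \<and> q \<in> S \<and> p \<bullet> (1, \<theta>) < q \<bullet> (1, \<theta>) \<and>
     \<not> (\<exists>r\<in>S. p \<bullet> (1, \<theta>) < r \<bullet> (1, \<theta>) \<and> r \<bullet> (1, \<theta>) < q \<bullet> (1, \<theta>))"

text \<open>The finite words read off the staircase of \<open>E0\<close>, along \<open>length w + 1\<close> consecutive points.\<close>

definition staircase_words :: "real \<Rightarrow> (real \<times> real) set \<Rightarrow> letter list set" where
  "staircase_words \<theta> E0 =
     {w. \<exists>p :: nat \<Rightarrow> real \<times> real. p 0 \<in> staircase E0 \<and>
           (\<forall>i<length w. consecutive \<theta> (staircase E0) (p i) (p (Suc i)) \<and>
                         p (Suc i) - p i = letter_step (w ! i))}"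

text \<open>For irrational \<open>\<theta>\<close> the set \<open>staircase_words \<theta> E0\<close> does not depend on the line \<open>E0\<close>, so the union
  below is the common value of these sets.\<close>

definition sturmian_language :: "real \<Rightarrow> letter list set" where
  "sturmian_language \<theta> = (\<Union>E0 \<in> {E0. sturmian_line \<theta> E0}. staircase_words \<theta> E0)"

text \<open>One-sided sequences are indexed from 0, so \<open>\<xi> 0\<close> is the first letter.\<close>

definition sturmian_subshift :: "real \<Rightarrow> (nat \<Rightarrow> letter) set" where
  "sturmian_subshift \<theta> = {\<xi>. \<forall>i n. map \<xi> [i..<i + n] \<in> sturmian_language \<theta>}"

text \<open>With indices starting at 0, the first index of disagreement is the length of the longest
  common prefix.\<close>

definition prefix_dist :: "(nat \<Rightarrow> real) \<Rightarrow> (nat \<Rightarrow> 'a) \<Rightarrow> (nat \<Rightarrow> 'a) \<Rightarrow> real" where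
  "prefix_dist \<delta> \<xi> \<eta> = (if \<xi> = \<eta> then 0 else \<delta> (LEAST n. \<xi> n \<noteq> \<eta> n))"

lemma Metric_space_prefix_dist:
  assumes pos: "\<And>n. 0 < \<delta> n" and decr: "\<And>m n. m < n \<Longrightarrow> \<delta> n < \<delta> m"
  shows "Metric_space M (prefix_dist \<delta>)"
proof
  have le: "\<delta> n \<le> \<delta> m" if "m \<le> n" for m n
    using decr[of m n] that by (cases "m = n") auto
  fix x y z :: "nat \<Rightarrow> 'a"
  show "0 \<le> prefix_dist \<delta> x y"
    using pos by (auto simp: prefix_dist_def intro: less_imp_le)
  show "prefix_dist \<delta> x y = prefix_dist \<delta> y x"
  proof -
    have "(\<lambda>n. x n \<noteq> y n) = (\<lambda>n. y n \<noteq> x n)" by auto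
    then have "(LEAST n. x n \<noteq> y n) = (LEAST n. y n \<noteq> x n)" by (rule arg_cong)
    then show ?thesis by (auto simp: prefix_dist_def)
  qed
  show "prefix_dist \<delta> x y = 0 \<longleftrightarrow> x = y"
    using pos[of "LEAST n. x n \<noteq> y n"] by (auto simp: prefix_dist_def)
  have nn: "0 \<le> \<delta> n" for n
    using pos[of n] by simp
  show "prefix_dist \<delta> x z \<le> prefix_dist \<delta> x y + prefix_dist \<delta> y z"
  proof (cases "x = z \<or> x = y \<or> y = z")
    case True
    then show ?thesis
      by (auto simp: prefix_dist_def nn)
  next
    case False
    define k where "k = (LEAST n. x n \<noteq> z n)"
    have "\<exists>n. x n \<noteq> z n"
      using False by (auto simp: fun_eq_iff)
    then have "x k \<noteq> z k"
      unfolding k_def by (rule LeastI_ex)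
    then consider "x k \<noteq> y k" | "y k \<noteq> z k" by fastforce
    then have "\<delta> k \<le> \<delta> (LEAST n. x n \<noteq> y n) + \<delta> (LEAST n. y n \<noteq> z n)"
    proof cases
      case 1
      then have "\<delta> k \<le> \<delta> (LEAST n. x n \<noteq> y n)" by (intro le Least_le)
      then show ?thesis using nn[of "LEAST n. y n \<noteq> z n"] by linarith
    next
      case 2
      then have "\<delta> k \<le> \<delta> (LEAST n. y n \<noteq> z n)" by (intro le Least_le)
      then show ?thesis using nn[of "LEAST n. x n \<noteq> y n"] by linarith
    qed
    then show ?thesis
      using False by (simp add: prefix_dist_def k_def)
  qed
qed

definition sturmian_topology :: "(nat \<Rightarrow> real) \<Rightarrow> real \<Rightarrow> (nat \<Rightarrow> letter) topology" where
  "sturmian_topology \<delta> \<theta> = Metric_space.mtopology (sturmian_subshift \<theta>) (prefix_dist \<delta>)"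

text \<open>A choice function is represented by the chosen letters: \<open>\<tau> w\<close> is \<open>a\<^sub>w\<close>, and the infinite sequence
  obtained from \<open>w\<close> is \<open>choice_seq \<tau> w\<close>.\<close>

definition choice_function :: "real \<Rightarrow> (letter list \<Rightarrow> letter) \<Rightarrow> bool" where
  "choice_function \<theta> \<tau> \<longleftrightarrow> (\<forall>w\<in>sturmian_language \<theta>. w @ [\<tau> w] \<in> sturmian_language \<theta>)"

fun choice_extend :: "(letter list \<Rightarrow> letter) \<Rightarrow> letter list \<Rightarrow> nat \<Rightarrow> letter list" where
  "choice_extend \<tau> w 0 = w"
| "choice_extend \<tau> w (Suc n) = choice_extend \<tau> w n @ [\<tau> (choice_extend \<tau> w n)]"

definition choice_seq :: "(letter list \<Rightarrow> letter) \<Rightarrow> letter list \<Rightarrow> nat \<Rightarrow> letter" where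
  "choice_seq \<tau> w n = choice_extend \<tau> w (Suc n) ! n"

type_synonym edge = "letter list \<times> letter list"

definition edges :: "real \<Rightarrow> edge set" where
  "edges \<theta> = {(u, v). u \<in> sturmian_language \<theta> \<and> v \<in> sturmian_language \<theta> \<and> u \<noteq> v \<and>
                (\<exists>n. length u = n + 1 \<and> length v = n + 1 \<and> take n u = take n v)}"

definition edge_length :: "(nat \<Rightarrow> real) \<Rightarrow> edge \<Rightarrow> real" where
  "edge_length \<delta> e = \<delta> (length (fst e) - 1)"

text \<open>Vectors of \<open>\<ell>\<^sup>2(A)\<close> are functions on the whole type, of which only the values on \<open>A\<close> matter.\<close>

definition ell2 :: "'a set \<Rightarrow> ('a \<Rightarrow> complex) set" where
  "ell2 A = {\<psi>. (\<lambda>e. (cmod (\<psi> e))\<^sup>2) summable_on A}"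

definition ell2_norm :: "'a set \<Rightarrow> ('a \<Rightarrow> complex) \<Rightarrow> real" where
  "ell2_norm A \<psi> = sqrt (\<Sum>\<^sub>\<infinity>e\<in>A. (cmod (\<psi> e))\<^sup>2)"

definition rep :: "(letter list \<Rightarrow> letter) \<Rightarrow> ((nat \<Rightarrow> letter) \<Rightarrow> complex) \<Rightarrow>
    (edge \<Rightarrow> complex) \<Rightarrow> edge \<Rightarrow> complex" where
  "rep \<tau> f \<psi> = (\<lambda>(u, v). f (choice_seq \<tau> u) * \<psi> (u, v))"

definition dirac :: "(nat \<Rightarrow> real) \<Rightarrow> (edge \<Rightarrow> complex) \<Rightarrow> edge \<Rightarrow> complex" where
  "dirac \<delta> \<psi> = (\<lambda>(u, v). of_real (inverse (edge_length \<delta> (u, v))) * \<psi> (v, u))"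

definition dirac_domain :: "(nat \<Rightarrow> real) \<Rightarrow> real \<Rightarrow> (edge \<Rightarrow> complex) set" where
  "dirac_domain \<delta> \<theta> = {\<psi> \<in> ell2 (edges \<theta>). dirac \<delta> \<psi> \<in> ell2 (edges \<theta>)}"

definition commutator :: "(nat \<Rightarrow> real) \<Rightarrow> (letter list \<Rightarrow> letter) \<Rightarrow> ((nat \<Rightarrow> letter) \<Rightarrow> complex) \<Rightarrow>
    (edge \<Rightarrow> complex) \<Rightarrow> edge \<Rightarrow> complex" where
  "commutator \<delta> \<tau> f \<psi> = (\<lambda>e. dirac \<delta> (rep \<tau> f \<psi>) e - rep \<tau> f (dirac \<delta> \<psi>) e)"

text \<open>The condition \<open>\<parallel>[D, \<pi>\<^sub>\<tau>(f)]\<parallel> \<le> 1\<close> for the commutator defined on the domain of the unbounded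
  operator \<open>D\<close>.\<close>

definition commutator_norm_le_1 ::
    "(nat \<Rightarrow> real) \<Rightarrow> real \<Rightarrow> (letter list \<Rightarrow> letter) \<Rightarrow> ((nat \<Rightarrow> letter) \<Rightarrow> complex) \<Rightarrow> bool" where
  "commutator_norm_le_1 \<delta> \<theta> \<tau> f \<longleftrightarrow>
     (\<forall>\<psi>\<in>dirac_domain \<delta> \<theta>. commutator \<delta> \<tau> f \<psi> \<in> ell2 (edges \<theta>) \<and>
        ell2_norm (edges \<theta>) (commutator \<delta> \<tau> f \<psi>) \<le> ell2_norm (edges \<theta>) \<psi>)"

lemma edges_swap: "(u, v) \<in> edges \<theta> \<Longrightarrow> (v, u) \<in> edges \<theta>"
  by (auto simp: edges_def)

lemma edge_length_swap: "(u, v) \<in> edges \<theta> \<Longrightarrow> edge_length \<delta> (v, u) = edge_length \<delta> (u, v)"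
  by (auto simp: edges_def edge_length_def)

lemma commutator_norm_le_1_iff:
  assumes pos: "\<And>n. 0 < \<delta> n"
  shows "commutator_norm_le_1 \<delta> \<theta> \<tau> f \<longleftrightarrow>
    (\<forall>(u, v)\<in>edges \<theta>. cmod (f (choice_seq \<tau> u) - f (choice_seq \<tau> v)) \<le> edge_length \<delta> (u, v))"
    (is "_ \<longleftrightarrow> ?R")
proof -
  let ?E = "edges \<theta>"
  have lpos: "0 < edge_length \<delta> e" for e
    using pos by (simp add: edge_length_def)
  have comm: "commutator \<delta> \<tau> f \<psi> (u, v) =
      (f (choice_seq \<tau> v) - f (choice_seq \<tau> u)) * \<psi> (v, u) / of_real (edge_length \<delta> (u, v))"
    for \<psi> u v
    by (simp add: commutator_def dirac_def rep_def divide_inverse algebra_simps)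
  have swap: "bij_betw prod.swap ?E ?E"
    by (rule bij_betwI[where g = prod.swap]) (auto intro: edges_swap)
  show ?thesis
  proof
    assume R: ?R
    show "commutator_norm_le_1 \<delta> \<theta> \<tau> f"
      unfolding commutator_norm_le_1_def
    proof
      fix \<psi> assume "\<psi> \<in> dirac_domain \<delta> \<theta>"
      then have sm: "(\<lambda>e. (cmod (\<psi> e))\<^sup>2) summable_on ?E"
        by (simp add: dirac_domain_def ell2_def)
      have sm': "(\<lambda>e. (cmod (\<psi> (prod.swap e)))\<^sup>2) summable_on ?E"
        using summable_on_reindex_bij_betw[OF swap, of "\<lambda>e. (cmod (\<psi> e))\<^sup>2"] sm by simp
      have le: "(cmod (commutator \<delta> \<tau> f \<psi> e))\<^sup>2 \<le> (cmod (\<psi> (prod.swap e)))\<^sup>2" if e: "e \<in> ?E" for e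
      proof -
        obtain u v where uv: "e = (u, v)" by (cases e)
        have "cmod (f (choice_seq \<tau> v) - f (choice_seq \<tau> u)) \<le> edge_length \<delta> (u, v)"
          using R e uv by (auto simp: norm_minus_commute)
        then have "cmod (commutator \<delta> \<tau> f \<psi> e) \<le> cmod (\<psi> (prod.swap e))"
          using lpos[of "(u, v)"] mult_right_mono[OF _ norm_ge_zero[of "\<psi> (v, u)"]]
          by (simp add: uv comm norm_divide norm_mult divide_le_eq mult.commute[of "cmod (\<psi> (v, u))"])
        then show ?thesis by (simp add: power_mono)
      qed
      have smc: "(\<lambda>e. (cmod (commutator \<delta> \<tau> f \<psi> e))\<^sup>2) summable_on ?E"
        by (rule summable_on_comparison_test[OF sm' le]) auto
      have "(\<Sum>\<^sub>\<infinity>e\<in>?E. (cmod (commutator \<delta> \<tau> f \<psi> e))\<^sup>2) \<le> (\<Sum>\<^sub>\<infinity>e\<in>?E. (cmod (\<psi> (prod.swap e)))\<^sup>2)"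
        by (rule infsum_mono[OF smc sm' le])
      also have "\<dots> = (\<Sum>\<^sub>\<infinity>e\<in>?E. (cmod (\<psi> e))\<^sup>2)"
        by (rule infsum_reindex_bij_betw[OF swap, of "\<lambda>e. (cmod (\<psi> e))\<^sup>2"])
      finally show "commutator \<delta> \<tau> f \<psi> \<in> ell2 ?E \<and>
          ell2_norm ?E (commutator \<delta> \<tau> f \<psi>) \<le> ell2_norm ?E \<psi>"
        using smc by (simp add: ell2_def ell2_norm_def)
    qed
  next
    assume L: "commutator_norm_le_1 \<delta> \<theta> \<tau> f"
    show ?R
    proof clarify
      fix u v assume uv: "(u, v) \<in> ?E"
      define \<psi> :: "edge \<Rightarrow> complex" where "\<psi> = (\<lambda>e. if e = (v, u) then 1 else 0)"
      have fin: "g summable_on ?E \<and> infsum g ?E = g a"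
        if "a \<in> ?E" "\<And>e. e \<noteq> a \<Longrightarrow> g e = 0" for g :: "edge \<Rightarrow> real" and a
      proof -
        have "(g has_sum g a) {a}" by (simp add: has_sum_finiteI)
        then have "(g has_sum g a) ?E"
          by (rule has_sum_cong_neutral[THEN iffD1, rotated -1]) (use that in auto)
        then show ?thesis by (auto simp: infsumI has_sum_imp_summable)
      qed
      have vu: "(v, u) \<in> ?E" using uv by (rule edges_swap)
      have 1: "\<psi> \<in> ell2 ?E" "ell2_norm ?E \<psi> = 1"
        using fin[OF vu, of "\<lambda>e. (cmod (\<psi> e))\<^sup>2"]
        by (auto simp: ell2_def ell2_norm_def \<psi>_def)
      have 2: "dirac \<delta> \<psi> \<in> ell2 ?E"
        unfolding ell2_def mem_Collect_eq
        by (rule conjunct1[OF fin[OF uv]]) (auto simp: dirac_def \<psi>_def split: if_splits)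
      have 3: "ell2_norm ?E (commutator \<delta> \<tau> f \<psi>) = cmod (commutator \<delta> \<tau> f \<psi> (u, v))"
        unfolding ell2_norm_def
        by (subst conjunct2[OF fin[OF uv]]) (auto simp: comm \<psi>_def split: if_splits)
      have "cmod (commutator \<delta> \<tau> f \<psi> (u, v)) \<le> 1"
        using L 1 2 3 by (auto simp: commutator_norm_le_1_def dirac_domain_def)
      then show "cmod (f (choice_seq \<tau> u) - f (choice_seq \<tau> v)) \<le> edge_length \<delta> (u, v)"
        using lpos[of "(u, v)"]
        by (simp add: comm \<psi>_def norm_divide divide_le_eq norm_minus_commute)
    qed
  qed
qed

definition spectral_dist :: "(nat \<Rightarrow> real) \<Rightarrow> real \<Rightarrow> (letter list \<Rightarrow> letter) \<Rightarrow>
    (nat \<Rightarrow> letter) \<Rightarrow> (nat \<Rightarrow> letter) \<Rightarrow> ennreal" where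
  "spectral_dist \<delta> \<theta> \<tau> x y =
     (SUP f \<in> {f :: (nat \<Rightarrow> letter) \<Rightarrow> complex.
                 continuous_map (sturmian_topology \<delta> \<theta>) euclidean f \<and>
                 commutator_norm_le_1 \<delta> \<theta> \<tau> f}.
        ennreal (cmod (f x - f y)))"

definition sup_spectral_dist :: "(nat \<Rightarrow> real) \<Rightarrow> real \<Rightarrow>
    (nat \<Rightarrow> letter) \<Rightarrow> (nat \<Rightarrow> letter) \<Rightarrow> ennreal" where
  "sup_spectral_dist \<delta> \<theta> x y = (SUP \<tau> \<in> {\<tau>. choice_function \<theta> \<tau>}. spectral_dist \<delta> \<theta> \<tau> x y)"

text \<open>Continuity as a real-valued function on the product of the subshift with itself; in particular
  the value \<open>\<infinity>\<close> is excluded.\<close>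

definition continuous_dist :: "(nat \<Rightarrow> real) \<Rightarrow> real \<Rightarrow>
    ((nat \<Rightarrow> letter) \<Rightarrow> (nat \<Rightarrow> letter) \<Rightarrow> ennreal) \<Rightarrow> bool" where
  "continuous_dist \<delta> \<theta> F \<longleftrightarrow>
     (\<forall>x\<in>sturmian_subshift \<theta>. \<forall>y\<in>sturmian_subshift \<theta>. F x y \<noteq> \<infinity>) \<and>
     continuous_map (prod_topology (sturmian_topology \<delta> \<theta>) (sturmian_topology \<delta> \<theta>)) euclideanreal
       (\<lambda>(x, y). enn2real (F x y))"

end

theory Submission
  imports Defs
begin

text \<open>
  Up to scaling, stepping along a staircase is the rotation of the circle by \<open>-\<alpha>\<close>, where
  \<open>\<alpha> = \<theta> / (1 + \<theta>)\<close>. Let \<open>x\<close> be the coding of the orbit of \<open>0\<close>. Its prefix of length \<open>n\<close> is right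
  special whenever the fractional part of \<open>(n + 1) \<alpha>\<close> is smaller than those of all earlier multiples
  of \<open>\<alpha>\<close>. Just to the left of a rational \<open>p / q\<close> such records occur along a long arithmetic
  progression of step \<open>q\<close>; as \<open>\<delta>\<close> decreases and is not summable, the sum of \<open>\<delta>\<close> over the progression
  is as large as desired. This being an open condition on \<open>\<alpha>\<close>, Baire's theorem gives an irrational
  \<open>\<alpha>\<close> for which the sum of \<open>\<delta>\<close> over the right special prefixes of \<open>x\<close> diverges.

  Let \<open>\<tau>\<close> deviate from \<open>x\<close> at each right special prefix. The finite sums of \<open>\<delta>\<^sub>i\<close> times the indicator
  function of the cylinder of sequences agreeing with \<open>x\<close> up to index \<open>i\<close>, over indices \<open>i\<close> of
  deviation, satisfy the commutator bound: beyond its own position an edge never follows \<open>x\<close> through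
  another deviation. Hence \<open>x\<close> is at infinite spectral distance from every other sequence.
\<close>

section \<open>Staircases and rotation codings\<close>

text \<open>The tested fractional part is the height of the \<open>i\<close>-th staircase point
  above the line, rescaled from \<open>(-\<theta>, 1)\<close> to \<open>(0, 1)\<close>. Both steps
  lower it by \<alpha> modulo 1; points below the line are left by a vertical step.\<close>

definition coding :: "real \<Rightarrow> real \<Rightarrow> nat \<Rightarrow> letter" where
  "coding \<alpha> s i = (if frac (s - real i * \<alpha>) < \<alpha> then Vert else Horiz)"

text \<open>Exactly the lines through lattice points correspond to the non-generic starting points.\<close>

definition generic :: "real \<Rightarrow> real \<Rightarrow> bool" where
  "generic \<alpha> s \<longleftrightarrow> (\<forall>a b :: int. s \<noteq> of_int a + of_int b * \<alpha>)"

section \<open>Lines and staircases in coordinates\<close>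

lemma sturmian_line_iff:
  "sturmian_line \<theta> E0 \<longleftrightarrow>
     (\<exists>c. E0 = {p. snd p = \<theta> * fst p + c} \<and> (\<forall>m n :: int. of_int n \<noteq> \<theta> * of_int m + c))"
proof -
  have eq: "{q + t *\<^sub>R (1, \<theta>) | t. True} = {p. snd p = \<theta> * fst p + (snd q - \<theta> * fst q)}" for q
  proof (intro equalityI subsetI)
    fix p assume "p \<in> {p. snd p = \<theta> * fst p + (snd q - \<theta> * fst q)}"
    then have "p = q + (fst p - fst q) *\<^sub>R (1, \<theta>)"
      by (auto simp: prod_eq_iff algebra_simps)
    then show "p \<in> {q + t *\<^sub>R (1, \<theta>) | t. True}" by blast
  qed (auto simp: algebra_simps)
  have disj: "{p. snd p = \<theta> * fst p + c} \<inter> (\<int> \<times> \<int>) = {} \<longleftrightarrow>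
      (\<forall>m n :: int. of_int n \<noteq> \<theta> * of_int m + c)" for c
  proof
    assume "{p. snd p = \<theta> * fst p + c} \<inter> (\<int> \<times> \<int>) = {}"
    moreover have "(of_int m, of_int n) \<in> \<int> \<times> \<int>" for m n :: int
      by simp
    ultimately have "(of_int m, of_int n) \<notin> {p. snd p = \<theta> * fst p + c}" for m n :: int
      by blast
    then show "\<forall>m n :: int. of_int n \<noteq> \<theta> * of_int m + c" by simp
  next
    assume *: "\<forall>m n :: int. of_int n \<noteq> \<theta> * of_int m + c"
    have False if "p \<in> \<int> \<times> \<int>" "snd p = \<theta> * fst p + c" for p
    proof -
      have "fst p \<in> \<int>" "snd p \<in> \<int>"
        using that(1) by (auto simp: mem_Times_iff)
      then obtain m n :: int where "fst p = of_int m" "snd p = of_int n"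
        by (elim Ints_cases)
      then show False using that(2) * by metis
    qed
    then show "{p. snd p = \<theta> * fst p + c} \<inter> (\<int> \<times> \<int>) = {}" by blast
  qed
  show ?thesis
  proof
    assume "sturmian_line \<theta> E0"
    then show "\<exists>c. E0 = {p. snd p = \<theta> * fst p + c} \<and> (\<forall>m n :: int. of_int n \<noteq> \<theta> * of_int m + c)"
      unfolding sturmian_line_def eq using disj by blast
  next
    assume "\<exists>c. E0 = {p. snd p = \<theta> * fst p + c} \<and> (\<forall>m n :: int. of_int n \<noteq> \<theta> * of_int m + c)"
    then obtain c where c: "E0 = {p. snd p = \<theta> * fst p + c}"
        "\<forall>m n :: int. of_int n \<noteq> \<theta> * of_int m + c"
      by blast
    have "E0 = {(0, c) + t *\<^sub>R (1, \<theta>) | t. True}"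
      unfolding eq using c(1) by simp
    then show "sturmian_line \<theta> E0"
      unfolding sturmian_line_def using c disj[of c] by blast
  qed
qed

text \<open>The unit square adds heights between \<open>-\<theta>\<close> and 1 to the line. The two
  extremes would put a lattice neighbour, the one on the left or the one below, on the line
  itself.\<close>

lemma staircase_iff:
  assumes \<theta>: "0 < \<theta>" and E0: "E0 = {p. snd p = \<theta> * fst p + c}"
    and c: "\<forall>m n :: int. of_int n \<noteq> \<theta> * of_int m + c"
  shows "(of_int m, of_int n) \<in> staircase E0 \<longleftrightarrow>
    - \<theta> < of_int n - \<theta> * of_int m - c \<and> of_int n - \<theta> * of_int m - c < 1"
    (is "?L \<longleftrightarrow> ?R")
proof
  let ?y = "of_int n - \<theta> * of_int m - c"
  assume ?L
  then obtain e z where "(of_int m, of_int n) = e + z" "snd e = \<theta> * fst e + c"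
      and z: "z \<in> {0..1} \<times> {0..1}"
    by (auto simp: staircase_def E0)
  then have y: "?y = snd z - \<theta> * fst z"
    by (auto simp: prod_eq_iff algebra_simps)
  have "\<theta> * fst z \<le> \<theta> * 1" "0 \<le> \<theta> * fst z"
    using z \<theta> by (auto intro!: mult_left_mono)
  moreover have "?y \<noteq> 1"
    using c[rule_format, of "n - 1" m] by auto
  moreover have "?y \<noteq> - \<theta>"
    using c[rule_format, of n "m - 1"] by (auto simp: algebra_simps)
  ultimately show ?R using y z by auto
next
  let ?y = "of_int n - \<theta> * of_int m - c"
  assume R: ?R
  \<comment> \<open>The line is reached straight down from a point above it and horizontally to the
    left from a point below it.\<close>
  have "\<exists>e z. (of_int m, of_int n) = e + z \<and> e \<in> E0 \<and> z \<in> {0..1} \<times> {0..1}"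
  proof (cases "0 \<le> ?y")
    case True
    show ?thesis
      by (rule exI[of _ "(of_int m, of_int n - ?y)"], rule exI[of _ "(0, ?y)"])
         (use True R in \<open>auto simp: E0\<close>)
  next
    case False
    show ?thesis
      by (rule exI[of _ "(of_int m + ?y / \<theta>, of_int n)"], rule exI[of _ "(- ?y / \<theta>, 0)"])
         (use False R \<theta> in \<open>auto simp: E0 field_simps\<close>)
  qed
  then show ?L by (auto simp: staircase_def)
qed

lemma staircase_Ints:
  assumes "p \<in> staircase E0"
  obtains m n :: int where "p = (of_int m, of_int n)"
proof -
  have "fst p \<in> \<int>" "snd p \<in> \<int>"
    using assms by (auto simp: staircase_def mem_Times_iff)
  then show thesis
    using that by (metis Ints_cases prod.collapse)
qed

text \<open>A displacement by \<open>(a, b)\<close> changes the height above the line by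
  \<open>b - \<theta> * a\<close>. One that ends strictly before the claimed successor is either
  impossible for integers or leaves the strip of heights between \<open>-\<theta>\<close> and
  1.\<close>

lemma staircase_step:
  assumes \<theta>: "0 < \<theta>" "\<theta> < 1" and E0: "E0 = {p. snd p = \<theta> * fst p + c}"
    and c: "\<forall>m n :: int. of_int n \<noteq> \<theta> * of_int m + c"
    and p: "(of_int m, of_int n) \<in> staircase E0"
  shows "consecutive \<theta> (staircase E0) (of_int m, of_int n) ((of_int m, of_int n) +
    letter_step (if of_int n - \<theta> * of_int m - c < 0 then Vert else Horiz))"
proof -
  note iff = staircase_iff[OF \<theta>(1) E0 c]
  have ip: "(x, y) \<bullet> (1, \<theta>) = x + \<theta> * y" for x y :: real
    by (simp add: inner_real_def)
  define y where "y = of_int n - \<theta> * of_int m - c"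
  have y: "-\<theta> < y" "y < 1" using p iff by (auto simp: y_def)
  have y0: "y \<noteq> 0" using c by (auto simp: y_def algebra_simps)
  have between: "\<exists>a b :: int. r = (of_int (m + a), of_int (n + b)) \<and>
      -\<theta> < y + b - \<theta> * a \<and> y + b - \<theta> * a < 1" if rS: "r \<in> staircase E0" for r
  proof -
    obtain m' n' :: int where r: "r = (of_int m', of_int n')"
      by (rule staircase_Ints[OF rS])
    show ?thesis
      using rS iff[of m' n'] unfolding r
      by (intro exI[of _ "m' - m"] exI[of _ "n' - n"]) (auto simp: y_def algebra_simps)
  qed
  show ?thesis
  proof (cases "y < 0")
    case True
    have q: "(of_int m, of_int (n + 1)) \<in> staircase E0"
      unfolding iff using True y \<theta> by (auto simp: y_def)
    have False if r: "r \<in> staircase E0" "(of_int m :: real, of_int n) \<bullet> (1, \<theta>) < r \<bullet> (1, \<theta>)"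
        "r \<bullet> (1, \<theta>) < (of_int m :: real, of_int (n + 1)) \<bullet> (1, \<theta>)" for r
    proof -
      obtain a b :: int where ab: "r = (of_int (m + a), of_int (n + b))"
          "-\<theta> < y + b - \<theta> * a" "y + b - \<theta> * a < 1"
        using between[OF r(1)] by blast
      have 1: "0 < a + \<theta> * b" "a + \<theta> * b < \<theta>"
        using r(2,3) unfolding ab(1) ip by (auto simp: algebra_simps)
      consider "a \<ge> 1" | "a = 0" | "a \<le> -1" by linarith
      then show False
      proof cases
        case a_ge: 1
        then have "\<theta> * of_int b < 0" using 1 \<theta> by linarith
        then have "b \<le> -1" using \<theta> by (simp add: mult_less_0_iff)
        moreover have "\<theta> * 1 \<le> \<theta> * of_int a" using a_ge \<theta> by (intro mult_left_mono) auto
        ultimately show False using ab(2) True by linarith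
      next
        case 2
        then have "0 < \<theta> * of_int b" "\<theta> * of_int b < \<theta> * 1" using 1 by auto
        then have "0 < b" "b < 1" using \<theta> by (auto simp: zero_less_mult_iff)
        then show False by simp
      next
        case 3
        then have "0 < \<theta> * of_int b" using 1 by linarith
        then have "b \<ge> 1" using \<theta> by (auto simp: zero_less_mult_iff)
        moreover have "\<theta> * of_int a \<le> \<theta> * (-1)" using 3 \<theta> by (intro mult_left_mono) auto
        ultimately show False using ab(3) y by linarith
      qed
    qed
    then show ?thesis
      using p q True \<theta> unfolding consecutive_def by (auto simp: y_def ip algebra_simps simp del: inner_Pair)
  next
    case False
    then have y_pos: "0 < y" using y0 by simp
    have q: "(of_int (m + 1), of_int n) \<in> staircase E0"
      unfolding iff using y_pos y \<theta> by (auto simp: y_def algebra_simps)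
    have False if r: "r \<in> staircase E0" "(of_int m :: real, of_int n) \<bullet> (1, \<theta>) < r \<bullet> (1, \<theta>)"
        "r \<bullet> (1, \<theta>) < (of_int (m + 1) :: real, of_int n) \<bullet> (1, \<theta>)" for r
    proof -
      obtain a b :: int where ab: "r = (of_int (m + a), of_int (n + b))"
          "-\<theta> < y + b - \<theta> * a" "y + b - \<theta> * a < 1"
        using between[OF r(1)] by blast
      have 1: "0 < a + \<theta> * b" "a + \<theta> * b < 1"
        using r(2,3) unfolding ab(1) ip by (auto simp: algebra_simps)
      show False
      proof (cases "a \<ge> 1")
        case True
        then have "\<theta> * of_int b < 0" using 1 by linarith
        then have "b \<le> -1" using \<theta> by (simp add: mult_less_0_iff)
        moreover have "\<theta> * 1 \<le> \<theta> * of_int a" using True \<theta> by (intro mult_left_mono) auto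
        ultimately show False using ab(2) y by linarith
      next
        case False
        then have "0 < \<theta> * of_int b" using 1 by linarith
        then have "b \<ge> 1" using \<theta> by (auto simp: zero_less_mult_iff)
        moreover have "\<theta> * of_int a \<le> 0" using False \<theta> by (simp add: mult_le_0_iff)
        ultimately show False using ab(3) y_pos by linarith
      qed
    qed
    then show ?thesis
      using p q False y_pos \<theta> unfolding consecutive_def
      by (auto simp: y_def ip algebra_simps simp del: inner_Pair)
  qed
qed

text \<open>Needed for choice functions to exist: a staircase goes on past the last point at which a
  word was read.\<close>

lemma sturmian_language_extend:
  assumes \<theta>: "0 < \<theta>" "\<theta> < 1" and w: "w \<in> sturmian_language \<theta>"
  shows "\<exists>a. w @ [a] \<in> sturmian_language \<theta>"
proof -
  obtain E0 p where E0: "sturmian_line \<theta> E0" and p0: "p 0 \<in> staircase E0"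
    and p: "\<forall>i<length w. consecutive \<theta> (staircase E0) (p i) (p (Suc i)) \<and>
                         p (Suc i) - p i = letter_step (w ! i)"
    using w by (auto simp: sturmian_language_def staircase_words_def)
  obtain c where c: "E0 = {p. snd p = \<theta> * fst p + c}"
      "\<forall>m n :: int. of_int n \<noteq> \<theta> * of_int m + c"
    using E0 sturmian_line_iff by blast
  have "p (length w) \<in> staircase E0"
    using p0 p by (cases "length w") (auto simp: consecutive_def)
  moreover then obtain m n :: int where mn: "p (length w) = (of_int m, of_int n)"
    using staircase_Ints by blast
  ultimately obtain a where a: "consecutive \<theta> (staircase E0) (p (length w)) (p (length w) + letter_step a)"
    using staircase_step[OF \<theta> c, of m n] by metis
  define p' where "p' = p(Suc (length w) := p (length w) + letter_step a)"
  have "w @ [a] \<in> staircase_words \<theta> E0"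
    unfolding staircase_words_def mem_Collect_eq
  proof (rule exI[of _ p'], intro conjI allI impI)
    fix i assume "i < length (w @ [a])"
    then show "consecutive \<theta> (staircase E0) (p' i) (p' (Suc i))"
        "p' (Suc i) - p' i = letter_step ((w @ [a]) ! i)"
      using a p by (auto simp: p'_def nth_append less_Suc_eq)
  qed (use p0 in \<open>simp add: p'_def\<close>)
  then show ?thesis using E0 by (auto simp: sturmian_language_def)
qed

lemma coding_in_sturmian_language:
  assumes \<alpha>: "0 < \<alpha>" "\<alpha> < 1/2" and s: "0 < s" "s < 1" and gen: "generic \<alpha> s"
  shows "map (coding \<alpha> s) [0..<k] \<in> sturmian_language (\<alpha> / (1 - \<alpha>))"
proof -
  define \<theta> where "\<theta> = \<alpha> / (1 - \<alpha>)"
  have \<theta>: "0 < \<theta>" "\<theta> < 1" using \<alpha> by (auto simp: \<theta>_def field_simps)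
  have \<alpha>\<theta>: "\<alpha> * (1 + \<theta>) = \<theta>" using \<alpha> by (simp add: \<theta>_def field_simps)
  \<comment> \<open>This intercept gives the origin the height
    \<open>(1 + \<theta>) * s - \<theta>\<close>, that is, the rescaled height
    \<open>s\<close>.\<close>
  define c where "c = \<theta> - (1 + \<theta>) * s"
  define E0 where "E0 = {p :: real \<times> real. snd p = \<theta> * fst p + c}"
  have c: "\<forall>m n :: int. of_int n \<noteq> \<theta> * of_int m + c"
  proof (intro allI notI)
    fix m n :: int assume "of_int n = \<theta> * of_int m + c"
    then have "(1 + \<theta>) * s = \<theta> * (of_int m + 1) - of_int n"
      by (simp add: c_def algebra_simps)
    also have "\<dots> = of_int (m + n + 1) * (\<alpha> * (1 + \<theta>)) - (1 + \<theta>) * of_int n"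
      unfolding \<alpha>\<theta> by (simp add: algebra_simps)
    also have "\<dots> = (1 + \<theta>) * (of_int (- n) + of_int (m + n + 1) * \<alpha>)"
      by (simp add: algebra_simps)
    finally have "s = of_int (- n) + of_int (m + n + 1) * \<alpha>" using \<theta> by simp
    then show False using gen unfolding generic_def by blast
  qed
  have line: "sturmian_line \<theta> E0" unfolding sturmian_line_iff using c E0_def by blast
  \<comment> \<open>After \<open>i\<close> steps from the origin the coordinates add up to
    \<open>i\<close>, and the vertical one counts the wrap-arounds of the rotation.\<close>
  define n where "n i = - \<lfloor>s - real i * \<alpha>\<rfloor>" for i :: nat
  define p where "p i = (of_int (int i - n i) :: real, of_int (n i) :: real)" for i
  have y: "of_int (n i) - \<theta> * of_int (int i - n i) - c = (1 + \<theta>) * frac (s - real i * \<alpha>) - \<theta>" for i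
  proof -
    have "(1 + \<theta>) * frac (s - real i * \<alpha>) = (1 + \<theta>) * s - i * (\<alpha> * (1 + \<theta>)) + (1 + \<theta>) * of_int (n i)"
      by (simp add: frac_def n_def algebra_simps)
    then show ?thesis unfolding \<alpha>\<theta> by (simp add: c_def algebra_simps)
  qed
  have ne0: "frac (s - real i * \<alpha>) \<noteq> 0" for i
  proof
    assume "frac (s - real i * \<alpha>) = 0"
    then have "s = of_int \<lfloor>s - real i * \<alpha>\<rfloor> + of_int (int i) * \<alpha>" by (simp add: frac_def)
    then show False using gen unfolding generic_def by blast
  qed
  have stair: "p i \<in> staircase E0" for i
  proof -
    have "0 < (1 + \<theta>) * frac (s - real i * \<alpha>)" "(1 + \<theta>) * frac (s - real i * \<alpha>) < (1 + \<theta>) * 1"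
      using ne0[of i] frac_ge_0[of "s - real i * \<alpha>"] \<theta> frac_lt_1[of "s - real i * \<alpha>"] by auto
    then show ?thesis
      unfolding p_def staircase_iff[OF \<theta>(1) E0_def c] y by auto
  qed
  have neg: "(1 + \<theta>) * f - \<theta> < 0 \<longleftrightarrow> f < \<alpha>" for f
  proof -
    have "(1 + \<theta>) * f - \<theta> = (1 + \<theta>) * (f - \<alpha>)" using \<alpha>\<theta> by (simp add: algebra_simps)
    then show ?thesis using \<theta> by (simp add: mult_less_0_iff)
  qed
  have n_Suc: "n (Suc i) = n i + (if frac (s - real i * \<alpha>) < \<alpha> then 1 else 0)" for i
  proof -
    have *: "s - real (Suc i) * \<alpha> = of_int (- n i) + (frac (s - real i * \<alpha>) - \<alpha>)"
      by (simp add: n_def frac_def algebra_simps)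
    have "\<lfloor>frac (s - real i * \<alpha>) - \<alpha>\<rfloor> = (if frac (s - real i * \<alpha>) < \<alpha> then -1 else 0)"
      using \<alpha> frac_lt_1[of "s - real i * \<alpha>"] frac_ge_0[of "s - real i * \<alpha>"]
      unfolding floor_eq_iff by (cases "frac (s - real i * \<alpha>) < \<alpha>") (auto simp del: frac_ge_0)
    then show ?thesis unfolding n_def[of "Suc i"] * by (simp add: int_add_floor[symmetric] del: of_int_minus)
  qed
  have p_Suc: "p (Suc i) = p i + letter_step (coding \<alpha> s i)" for i
    by (auto simp: p_def n_Suc coding_def)
  have cons: "consecutive \<theta> (staircase E0) (p i) (p (Suc i))" for i
    using staircase_step[OF \<theta> E0_def c stair[of i, unfolded p_def]]
    unfolding p_Suc y neg by (simp add: p_def coding_def)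
  have "map (coding \<alpha> s) [0..<k] \<in> staircase_words \<theta> E0"
    unfolding staircase_words_def mem_Collect_eq
    using stair cons by (intro exI[of _ p]) (auto simp flip: p_Suc, simp add: p_Suc)
  then show ?thesis using line by (auto simp: sturmian_language_def \<theta>_def)
qed

section \<open>Shifted codings and generic starting points\<close>

lemma coding_shift: "coding \<alpha> s (i + j) = coding \<alpha> (frac (s - real i * \<alpha>)) j"
proof -
  have "frac (frac (s - real i * \<alpha>) - real j * \<alpha>) =
      frac ((s - real i * \<alpha> - real j * \<alpha>) + of_int (- \<lfloor>s - real i * \<alpha>\<rfloor>))"
    by (simp add: frac_def algebra_simps)
  also have "\<dots> = frac (s - real i * \<alpha> - real j * \<alpha>)"
    by (rule frac_add_of_int_right)
  finally show ?thesis by (simp add: coding_def algebra_simps)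
qed


lemma generic_frac_shift:
  assumes "generic \<alpha> s"
  shows "generic \<alpha> (frac (s - real i * \<alpha>))"
  unfolding generic_def
proof (intro allI notI)
  fix a b :: int assume "frac (s - real i * \<alpha>) = of_int a + of_int b * \<alpha>"
  then have "s = of_int (a + \<lfloor>s - real i * \<alpha>\<rfloor>) + of_int (b + int i) * \<alpha>"
    by (simp add: frac_def algebra_simps)
  then show False using assms unfolding generic_def by blast
qed

lemma coding_factor_in_sturmian_language:
  assumes \<alpha>: "0 < \<alpha>" "\<alpha> < 1/2" and gen: "generic \<alpha> s"
  shows "map (coding \<alpha> s) [i..<i + k] \<in> sturmian_language (\<alpha> / (1 - \<alpha>))"
proof -
  let ?s = "frac (s - real i * \<alpha>)"
  have g: "generic \<alpha> ?s" using gen by (rule generic_frac_shift)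
  then have "?s \<noteq> of_int 0 + of_int 0 * \<alpha>" unfolding generic_def by blast
  then have "0 < ?s" using frac_ge_0[of "s - real i * \<alpha>"] by (simp del: frac_ge_0)
  then have "map (coding \<alpha> ?s) [0..<k] \<in> sturmian_language (\<alpha> / (1 - \<alpha>))"
    using coding_in_sturmian_language[OF \<alpha> _ frac_lt_1 g] by simp
  moreover have "map (coding \<alpha> s) [i..<i + k] = map (coding \<alpha> ?s) [0..<k]"
    by (rule nth_equalityI) (auto simp: coding_shift)
  ultimately show ?thesis by simp
qed

lemma ex_generic_between:
  assumes "l < u" shows "\<exists>s. generic \<alpha> s \<and> l < s \<and> s < u"
proof -
  have "{s. \<not> generic \<alpha> s} = range (\<lambda>(a :: int, b :: int). of_int a + of_int b * \<alpha>)"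
    by (auto simp: generic_def)
  then have "countable {s. \<not> generic \<alpha> s}" by simp
  then have "\<not> {l<..<u} \<subseteq> {s. \<not> generic \<alpha> s}"
    using uncountable_open_interval[of l u] assms countable_subset by blast
  then show ?thesis by auto
qed

section \<open>Record minima and right special prefixes\<close>

text \<open>For irrational \<alpha> these are the denominators \<open>n\<close> of the best lower
  approximations \<open>p / n\<close>, measured by \<open>n * \<alpha> - p\<close>.\<close>

definition record_min :: "real \<Rightarrow> nat \<Rightarrow> bool" where
  "record_min \<alpha> n \<longleftrightarrow> 1 \<le> n \<and> (\<forall>j. 1 \<le> j \<and> j < n \<longrightarrow> frac (real n * \<alpha>) < frac (real j * \<alpha>))"

text \<open>Supplies generic starting points below the first discontinuities of the coding: with
  \<open>l = 0\<close> they imitate the starting point 0, with \<open>l\<close> a record value they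
  lie just past a single discontinuity.\<close>

lemma ex_generic_below_fracs:
  assumes "l < 1" "\<And>j. 1 \<le> j \<Longrightarrow> j \<le> N \<Longrightarrow> l < frac (real j * \<alpha>)"
  shows "\<exists>s. generic \<alpha> s \<and> l < s \<and> s < 1 \<and> (\<forall>j. 1 \<le> j \<and> j \<le> N \<longrightarrow> s < frac (real j * \<alpha>))"
proof -
  let ?F = "insert 1 ((\<lambda>j. frac (real j * \<alpha>)) ` {1..N})"
  have "l < Min ?F" using assms by (subst Min_gr_iff) auto
  then obtain s where s: "generic \<alpha> s" "l < s" "s < Min ?F" using ex_generic_between by blast
  then have "\<forall>t\<in>?F. s < t" by (subst (asm) Min_gr_iff) auto
  then show ?thesis using s by auto
qed

section \<open>Fractional parts near the orbit of 0\<close>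

lemma frac_add_small:
  fixes s z :: real
  assumes "0 \<le> s" "s + frac z < 1" shows "frac (s + z) = s + frac z"
  using assms frac_add[of s z] frac_ge_0[of z] by (simp add: frac_eq)

lemma frac_multiple_pos:
  assumes "\<alpha> \<notin> \<rat>" "1 \<le> j" shows "0 < frac (real j * \<alpha>)"
proof -
  have "real j * \<alpha> \<notin> \<int>"
  proof
    assume "real j * \<alpha> \<in> \<int>"
    then have "real j * \<alpha> / real j \<in> \<rat>" using Ints_subset_Rats by (intro Rats_divide) auto
    then show False using assms by simp
  qed
  then show ?thesis by simp
qed

lemma frac_uminus_multiple:
  assumes "\<alpha> \<notin> \<rat>" "1 \<le> j" shows "frac (- (real j * \<alpha>)) = 1 - frac (real j * \<alpha>)"
  using frac_multiple_pos[OF assms] by (simp add: frac_neg)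

text \<open>No wrap-around occurs, since \<open>frac (- (real i * \<alpha>))\<close> is
  \<open>1 - frac (real i * \<alpha>)\<close> for \<open>i \<ge> 1\<close>.\<close>

lemma frac_code_arg:
  assumes irr: "\<alpha> \<notin> \<rat>" and s: "0 < s" "s < 1" "1 \<le> i \<Longrightarrow> s < frac (real i * \<alpha>)"
  shows "frac (s - real i * \<alpha>) = s + frac (- (real i * \<alpha>))"
proof -
  have "s + frac (- (real i * \<alpha>)) < 1"
    using s frac_uminus_multiple[OF irr, of i] by (cases "i = 0") auto
  then show ?thesis using frac_add_small[of s "- (real i * \<alpha>)"] s by simp
qed

lemma frac_Suc_multiple:
  assumes \<alpha>: "0 < \<alpha>" "\<alpha> < 1/2" and g: "frac (- (real i * \<alpha>)) < \<alpha>"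
  shows "frac (real (Suc i) * \<alpha>) = \<alpha> - frac (- (real i * \<alpha>))"
proof -
  have "real (Suc i) * \<alpha> - (\<alpha> - frac (- (real i * \<alpha>))) = of_int (- \<lfloor>- (real i * \<alpha>)\<rfloor>)"
    by (simp add: frac_def algebra_simps)
  then have "real (Suc i) * \<alpha> - (\<alpha> - frac (- (real i * \<alpha>))) \<in> \<int>"
    by (simp only: Ints_of_int)
  moreover have "0 \<le> \<alpha> - frac (- (real i * \<alpha>))" "\<alpha> - frac (- (real i * \<alpha>)) < 1"
    using g \<alpha> frac_ge_0[of "- (real i * \<alpha>)"] by linarith+
  ultimately show ?thesis unfolding frac_unique_iff by blast
qed

text \<open>Adding \<open>s\<close> without wrap-around cannot bring a value from above \<alpha> to
  below it. A value below \<alpha> stays there, because its gap to \<alpha> is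
  \<open>frac (real (Suc i) * \<alpha>)\<close>, which exceeds \<open>s\<close>.\<close>

lemma coding_near_0:
  assumes \<alpha>: "0 < \<alpha>" "\<alpha> < 1/2" "\<alpha> \<notin> \<rat>"
    and s: "0 < s" "s < 1" "1 \<le> i \<Longrightarrow> s < frac (real i * \<alpha>)" "s < frac (real (Suc i) * \<alpha>)"
  shows "coding \<alpha> s i = coding \<alpha> 0 i"
  using frac_code_arg[OF \<alpha>(3) s(1,2,3)] frac_Suc_multiple[OF \<alpha>(1,2), of i] s
  by (auto simp: coding_def)

text \<open>The coding changes at index \<open>i\<close> as the starting point crosses the fractional part of
  \<open>(i + 1) \<alpha>\<close>, the preimage of the discontinuity \<open>\<alpha>\<close> under \<open>i\<close> rotations.\<close>

lemma coding_past_record: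
  assumes \<alpha>: "0 < \<alpha>" "\<alpha> < 1/2" "\<alpha> \<notin> \<rat>" and rec: "record_min \<alpha> (Suc i)"
    and s: "0 < s" "s < 1" "1 \<le> i \<Longrightarrow> s < frac (real i * \<alpha>)" "frac (real (Suc i) * \<alpha>) < s"
  shows "coding \<alpha> s i \<noteq> coding \<alpha> 0 i"
proof (cases "frac (- (real i * \<alpha>)) < \<alpha>")
  case True
  then show ?thesis
    using frac_code_arg[OF \<alpha>(3) s(1,2,3)] frac_Suc_multiple[OF \<alpha>(1,2), of i] s
    by (auto simp: coding_def)
next
  case False
  then have i: "1 \<le> i" using \<alpha>(1) by (cases i) auto
  \<comment> \<open>One more rotation does not wrap around here, so the fractional part of the
    multiple grows by \<alpha> and \<open>Suc i\<close> cannot be a record.\<close>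
  have "frac (- (real (Suc i) * \<alpha>)) = frac (- (real i * \<alpha>)) - \<alpha>"
  proof -
    have "- (real (Suc i) * \<alpha>) - (frac (- (real i * \<alpha>)) - \<alpha>) = of_int \<lfloor>- (real i * \<alpha>)\<rfloor>"
      by (simp add: frac_def algebra_simps)
    then show ?thesis
      unfolding frac_unique_iff using False \<alpha>(1) frac_lt_1[of "- (real i * \<alpha>)"]
      by (simp only: Ints_of_int) simp
  qed
  then have "frac (real i * \<alpha>) < frac (real (Suc i) * \<alpha>)"
    using frac_uminus_multiple[OF \<alpha>(3), of "Suc i"] frac_uminus_multiple[OF \<alpha>(3) i] \<alpha>(1) by simp
  then show ?thesis using rec i by (auto simp: record_min_def dest: spec[of _ i])
qed

text \<open>The starting point 0 is not generic, but each finite factor of its coding is shared with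
  a generic starting point slightly to its right.\<close>

lemma coding_0_in_subshift:
  assumes \<alpha>: "0 < \<alpha>" "\<alpha> < 1/2" "\<alpha> \<notin> \<rat>"
  shows "coding \<alpha> 0 \<in> sturmian_subshift (\<alpha> / (1 - \<alpha>))"
  unfolding sturmian_subshift_def mem_Collect_eq
proof (intro allI)
  fix i n
  obtain s where s: "generic \<alpha> s" "0 < s" "s < 1" "\<forall>j. 1 \<le> j \<and> j \<le> i + n \<longrightarrow> s < frac (real j * \<alpha>)"
    using ex_generic_below_fracs[of 0 "i + n" \<alpha>] frac_multiple_pos[OF \<alpha>(3)] by auto
  have "map (coding \<alpha> 0) [i..<i + n] = map (coding \<alpha> s) [i..<i + n]"
    using s(4) by (auto intro!: coding_near_0[OF \<alpha> s(2,3), symmetric] simp del: of_nat_Suc)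
  then show "map (coding \<alpha> 0) [i..<i + n] \<in> sturmian_language (\<alpha> / (1 - \<alpha>))"
    using coding_factor_in_sturmian_language[OF \<alpha>(1,2) s(1)] by (simp only:)
qed

text \<open>The record property leaves room for a generic \<open>s\<close> above
  \<open>frac (real (Suc n) * \<alpha>)\<close> and below all earlier fractional parts. Its coding
  agrees with that of 0 before index \<open>n\<close> and differs there.\<close>

lemma right_special_prefix:
  assumes \<alpha>: "0 < \<alpha>" "\<alpha> < 1/2" "\<alpha> \<notin> \<rat>" and rec: "record_min \<alpha> (Suc n)"
  obtains a where "a \<noteq> coding \<alpha> 0 n"
    "map (coding \<alpha> 0) [0..<n] @ [a] \<in> sturmian_language (\<alpha> / (1 - \<alpha>))"
proof -
  let ?l = "frac (real (Suc n) * \<alpha>)"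
  have pos: "0 < ?l" using frac_multiple_pos[OF \<alpha>(3), of "Suc n"] by simp
  obtain s where s: "generic \<alpha> s" "?l < s" "s < 1" "\<forall>j. 1 \<le> j \<and> j \<le> n \<longrightarrow> s < frac (real j * \<alpha>)"
    using ex_generic_below_fracs[of ?l n \<alpha>] frac_lt_1[of "real (Suc n) * \<alpha>"] rec
    unfolding record_min_def by (metis less_Suc_eq_le)
  have s0: "0 < s" using pos s(2) by linarith
  have eq: "map (coding \<alpha> 0) [0..<n] = map (coding \<alpha> s) [0..<n]"
    using s(4) by (auto intro!: coding_near_0[OF \<alpha> s0 s(3), symmetric] simp del: of_nat_Suc)
  show thesis
  proof (rule that)
    show "coding \<alpha> s n \<noteq> coding \<alpha> 0 n"
      using s by (intro coding_past_record[OF \<alpha> rec s0]) auto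
    show "map (coding \<alpha> 0) [0..<n] @ [coding \<alpha> s n] \<in> sturmian_language (\<alpha> / (1 - \<alpha>))"
      using coding_factor_in_sturmian_language[OF \<alpha>(1,2) s(1), of 0 "Suc n"] unfolding eq by simp
  qed
qed

text \<open>The residue of \<open>j * p\<close> is taken in \<open>1..q\<close> rather than
  \<open>0..q - 1\<close>: subtracting a small amount from an integer lands just below 1.\<close>

lemma frac_left_of_rational:
  fixes p q :: int
  assumes q: "0 < q" and j: "1 \<le> j" and \<epsilon>: "0 < \<epsilon>" "real j * \<epsilon> < 1 / q"
  shows "frac (real j * (p / q - \<epsilon>)) = (1 + (int j * p - 1) mod q) / q - real j * \<epsilon>"
proof -
  define t where "t = (int j * p - 1) div q"
  define \<rho> where "\<rho> = 1 + (int j * p - 1) mod q"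
  have \<rho>: "1 \<le> \<rho>" "\<rho> \<le> q"
    using pos_mod_bound[OF q, of "int j * p - 1"] pos_mod_sign[OF q, of "int j * p - 1"]
    unfolding \<rho>_def by linarith+
  have "int j * p = q * t + \<rho>" by (simp add: t_def \<rho>_def)
  then have "real j * p = q * t + \<rho>" by (metis of_int_add of_int_mult of_int_of_nat_eq)
  then have "real j * (p / q - \<epsilon>) = t + (\<rho> / q - real j * \<epsilon>)"
    using q by (simp add: field_simps)
  then have "real j * (p / q - \<epsilon>) - (\<rho> / q - real j * \<epsilon>) \<in> \<int>" by simp
  moreover have "1 / q \<le> \<rho> / q" using \<rho> q by (intro divide_right_mono) auto
  moreover have "\<rho> / q \<le> 1" using \<rho> q by simp
  moreover have "0 < real j * \<epsilon>" using \<epsilon>(1) j by simp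
  ultimately show ?thesis
    unfolding frac_unique_iff \<rho>_def[symmetric] using \<epsilon>(2) by auto
qed

text \<open>At \<open>n\<close> the residue has its least value 1, and among equal residues the
  larger multiple loses more through \<epsilon>.\<close>

lemma record_min_left_of_rational:
  fixes p q :: int
  assumes q: "0 < q" and \<epsilon>: "0 < \<epsilon>" "real n * \<epsilon> < 1 / q" and n: "1 \<le> n" "q dvd int n * p - 1"
  shows "record_min (p / q - \<epsilon>) n"
  unfolding record_min_def
proof (intro conjI allI impI n)
  fix j assume j: "1 \<le> j \<and> j < n"
  then have less: "real j * \<epsilon> < real n * \<epsilon>" using \<epsilon> by simp
  have fn: "frac (real n * (p / q - \<epsilon>)) = 1 / q - real n * \<epsilon>"
    using frac_left_of_rational[OF q n(1) \<epsilon>, of p] n by (simp add: dvd_eq_mod_eq_0)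
  have "1 / q \<le> (1 + (int j * p - 1) mod q) / q"
    using q by (intro divide_right_mono) auto
  moreover have "frac (real j * (p / q - \<epsilon>)) = (1 + (int j * p - 1) mod q) / q - real j * \<epsilon>"
    using frac_left_of_rational[OF q _ \<epsilon>(1), of j p] j \<epsilon> less by simp
  ultimately show "frac (real n * (p / q - \<epsilon>)) < frac (real j * (p / q - \<epsilon>))"
    using fn less by linarith
qed

section \<open>A slope with many records\<close>

text \<open>By monotonicity a block of \<open>q\<close> consecutive terms is at most
  \<open>q\<close> times its first term, so bounded sums along the progression would bound all
  partial sums.\<close>

lemma sum_arith_progression_unbounded:
  fixes \<delta> :: "nat \<Rightarrow> real"
  assumes pos: "\<And>n. 0 < \<delta> n" and decr: "\<And>m n. m < n \<Longrightarrow> \<delta> n < \<delta> m"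
    and div: "\<not> summable \<delta>" and q: "1 \<le> q"
  shows "\<exists>K. B \<le> (\<Sum>k<K. \<delta> (a + k * q))"
proof (rule ccontr)
  assume neg: "\<not> ?thesis"
  have le: "\<delta> n \<le> \<delta> m" if "m \<le> n" for m n
    using decr[of m n] that by (cases "m = n") auto
  have block: "(\<Sum>i<K * q. \<delta> (a + i)) \<le> q * (\<Sum>k<K. \<delta> (a + k * q))" for K
  proof -
    have "(\<Sum>i<K * q. \<delta> (a + i)) = (\<Sum>k<K. \<Sum>i = k * q..<k * q + q. \<delta> (a + i))"
      by (rule sum.nat_group[symmetric])
    also have "\<dots> \<le> (\<Sum>k<K. \<Sum>i = k * q..<k * q + q. \<delta> (a + k * q))"
      by (intro sum_mono le) simp
    finally show ?thesis by (simp add: sum_distrib_left)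
  qed
  have "(\<Sum>i<n. \<delta> (a + i)) \<le> q * B" for n
  proof -
    have "n \<le> n * q" using q by simp
    then have "(\<Sum>i<n. \<delta> (a + i)) \<le> (\<Sum>i<n * q. \<delta> (a + i))"
      using pos by (intro sum_mono2) (auto intro: less_imp_le)
    also have "\<dots> \<le> q * (\<Sum>k<n. \<delta> (a + k * q))" by (rule block)
    also have "\<dots> \<le> q * B" using neg by (intro mult_left_mono) (auto simp: not_le intro: less_imp_le)
    finally show ?thesis .
  qed
  then have "summable (\<lambda>i. \<delta> (a + i))"
    using pos by (intro summableI_nonneg_bounded) (auto intro: less_imp_le)
  then show False using div by (simp add: add.commute summable_iff_shift)
qed

lemma ex_slope_with_many_records:
  fixes \<delta> :: "nat \<Rightarrow> real"
  assumes pos: "\<And>n. 0 < \<delta> n" and decr: "\<And>m n. m < n \<Longrightarrow> \<delta> n < \<delta> m"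
    and div: "\<not> summable \<delta>" and lu: "l < u"
  obtains \<alpha> where "l < \<alpha>" "\<alpha> < u" "\<alpha> \<notin> \<rat>"
    "\<And>B. \<exists>F. finite F \<and> (\<forall>n\<in>F. record_min \<alpha> (Suc n)) \<and> B \<le> sum \<delta> F"
proof -
  define good where "good B \<alpha> \<longleftrightarrow> (\<exists>F. finite F \<and> (\<forall>n\<in>F. record_min \<alpha> (Suc n)) \<and> B \<le> sum \<delta> F)" for B \<alpha>
  \<comment> \<open>With interiors openness is automatic; for density, every neighbourhood has to
    contain an interval of slopes good for \<open>m\<close>.\<close>
  define G where "G m = interior {\<alpha>. good (real m) \<alpha>}" for m :: nat
  have dense_G: "UNIV \<subseteq> closure (G m)" for m
  proof
    fix z :: real
    show "z \<in> closure (G m)"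
      unfolding closure_approachable
    proof (intro allI impI)
      fix e :: real assume e: "0 < e"
      \<comment> \<open>The rational is taken to the right of \<open>z\<close>, so that slopes just
        left of it are still within \<open>e\<close> of \<open>z\<close>.\<close>
      obtain z' where z': "z' \<in> \<rat>" "z < z'" "z' < z + e"
        using Rats_dense_in_real[of z "z + e"] e by auto
      obtain p q :: int where pq: "0 < q" "coprime p q" "z' = p / q"
        using z'(1) by (elim Rats_cases') metis
      obtain v w where vw: "v * p + w * q = 1"
        using bezout_int[of p q] pq(2) by auto
      \<comment> \<open>\<open>r\<close> is an inverse of \<open>p\<close> modulo \<open>q\<close>: the records are at \<open>r + k q\<close>.\<close>
      define r where "r = nat (v mod q + q)"
      have vq: "0 \<le> v mod q" using pq(1) by simp
      \<comment> \<open>The added \<open>q\<close> makes \<open>r\<close> positive even when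
        \<open>v mod q = 0\<close>.\<close>
      then have r: "1 \<le> r" "int r = v mod q + q" using pq(1) unfolding r_def by linarith+
      have dvd: "q dvd int (r + k * nat q) * p - 1" for k
      proof -
        define c where "c = 1 + int k - v div q"
        have "v mod q = v - q * (v div q)" by (simp add: minus_mult_div_eq_mod)
        then have "int (r + k * nat q) = v + q * c"
          using r(2) pq(1) by (simp add: c_def algebra_simps)
        then have "int (r + k * nat q) * p - 1 = (v * p - 1) + q * (c * p)"
          by (simp only:) (simp add: algebra_simps)
        also have "v * p - 1 = q * (- w)" using vw by (simp add: mult.commute[of w q])
        finally show ?thesis by simp
      qed
      have "1 \<le> nat q" using pq(1) by simp
      \<comment> \<open>The progression starts at \<open>r - 1\<close> because a record at
        \<open>n + 1\<close> contributes \<open>\<delta> n\<close>.\<close>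
      then obtain K where K: "real m \<le> (\<Sum>k<K. \<delta> (r - 1 + k * nat q))"
        using sum_arith_progression_unbounded[OF pos decr div] by blast
      \<comment> \<open>\<open>R\<close> exceeds all records used, so an offset below
        \<open>1 / (q * R)\<close> keeps their displacement below \<open>1 / q\<close>.\<close>
      define R where "R = real (r + K * nat q)"
      have R: "0 < R" using r(1) by (simp add: R_def add_pos_nonneg)
      define \<eta> where "\<eta> = 1 / (q * R)"
      have \<eta>: "0 < \<eta>" using R pq(1) by (simp add: \<eta>_def)
      have sub: "{z' - \<eta><..<z'} \<subseteq> {\<alpha>. good (real m) \<alpha>}"
      proof
        fix \<alpha> assume \<alpha>: "\<alpha> \<in> {z' - \<eta><..<z'}"
        define \<epsilon> where "\<epsilon> = z' - \<alpha>"
        have \<epsilon>: "0 < \<epsilon>" "\<epsilon> < \<eta>" "\<alpha> = p / q - \<epsilon>" using \<alpha> pq(3) by (auto simp: \<epsilon>_def)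
        have rec: "record_min \<alpha> (r + k * nat q)" if "k < K" for k
          unfolding \<epsilon>(3)
        proof (rule record_min_left_of_rational[OF pq(1) \<epsilon>(1) _ _ dvd])
          have "real (r + k * nat q) \<le> R" using that by (simp add: R_def mult_right_mono)
          then have "real (r + k * nat q) * \<epsilon> \<le> R * \<epsilon>" using \<epsilon> by (intro mult_right_mono) auto
          also have "\<dots> < R * \<eta>" using \<epsilon> R by simp
          also have "\<dots> = 1 / q" using R by (simp add: \<eta>_def)
          finally show "real (r + k * nat q) * \<epsilon> < 1 / q" .
        qed (use r(1) in simp)
        let ?F = "(\<lambda>k. r - 1 + k * nat q) ` {..<K}"
        have "inj_on (\<lambda>k. r - 1 + k * nat q) {..<K}" using pq(1) by (auto simp: inj_on_def)
        then have "sum \<delta> ?F = (\<Sum>k<K. \<delta> (r - 1 + k * nat q))" by (simp add: sum.reindex)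
        moreover have "record_min \<alpha> (Suc n)" if "n \<in> ?F" for n
          using that rec r(1) by auto
        ultimately have "good (real m) \<alpha>"
          unfolding good_def using K by (intro exI[of _ ?F]) auto
        then show "\<alpha> \<in> {\<alpha>. good (real m) \<alpha>}" by simp
      qed
      obtain y where y: "max z (z' - \<eta>) < y" "y < z'"
        using dense[of "max z (z' - \<eta>)" z'] z' \<eta> by auto
      then have "y \<in> G m"
        unfolding G_def using interior_maximal[OF sub] by auto
      moreover have "dist y z < e" using y z' by (auto simp: dist_real_def)
      ultimately show "\<exists>y\<in>G m. dist y z < e" by blast
    qed
  qed
  \<comment> \<open>Complements of single rationals join the countable family of dense open sets,
    which forces the slope found to be irrational.\<close>
  let ?\<G> = "range G \<union> (\<lambda>r. - {r}) ` \<rat>"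
  have "UNIV \<subseteq> closure (\<Inter>?\<G>)"
  proof (rule Baire)
    show "countable ?\<G>" by (simp add: countable_rat)
    fix T assume "T \<in> ?\<G>"
    then show "openin (top_of_set UNIV) T \<and> UNIV \<subseteq> closure T"
      using dense_G by (auto simp: G_def closure_complement)
  qed simp
  then have "(l + u) / 2 \<in> {l<..<u} \<inter> closure (\<Inter>?\<G>)"
    using lu by (auto simp: field_simps)
  then have "{l<..<u} \<inter> closure (\<Inter>?\<G>) \<noteq> {}"
    by (metis empty_iff)
  then have "{l<..<u} \<inter> \<Inter>?\<G> \<noteq> {}"
    unfolding open_Int_closure_eq_empty[OF open_greaterThanLessThan] .
  then obtain \<alpha> where \<alpha>: "\<alpha> \<in> {l<..<u}" "\<alpha> \<in> \<Inter>?\<G>"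
    unfolding ex_in_conv[symmetric] by (elim exE IntE)
  have "good B \<alpha>" for B
  proof -
    obtain m where "B \<le> real m" using real_arch_simple by blast
    moreover have "good (real m) \<alpha>" using \<alpha>(2) interior_subset[of "{\<alpha>. good (real m) \<alpha>}"] by (auto simp: G_def)
    ultimately show ?thesis unfolding good_def by (meson order_trans)
  qed
  moreover have "\<alpha> \<notin> \<rat>" using \<alpha>(2) by auto
  ultimately show thesis using that \<alpha>(1) unfolding good_def by auto
qed

section \<open>The spectral distance\<close>

lemma length_choice_extend [simp]: "length (choice_extend \<tau> w n) = length w + n"
  by (induction n) auto

lemma choice_extend_nth_stable:
  assumes "i < length w + m" "m \<le> n"
  shows "choice_extend \<tau> w n ! i = choice_extend \<tau> w m ! i"
  using assms(2,1) by (induction n rule: dec_induct) (auto simp: nth_append)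

lemma choice_seq_prefix:
  assumes "i < length w" shows "choice_seq \<tau> w i = w ! i"
  using choice_extend_nth_stable[of i w 0 "Suc i" \<tau>] assms by (simp add: choice_seq_def del: choice_extend.simps(2))

lemma choice_seq_nth:
  assumes "i < length w + n" shows "choice_seq \<tau> w i = choice_extend \<tau> w n ! i"
  using choice_extend_nth_stable[of i w "Suc i" "max n (Suc i)" \<tau>]
    choice_extend_nth_stable[of i w n "max n (Suc i)" \<tau>] assms
  by (simp add: choice_seq_def del: choice_extend.simps(2))

lemma choice_seq_chosen:
  assumes "length w \<le> n"
  shows "choice_seq \<tau> w n = \<tau> (map (choice_seq \<tau> w) [0..<n])"
proof -
  define k where "k = n - length w"
  have n: "n = length w + k" using assms by (simp add: k_def)
  have "map (choice_seq \<tau> w) [0..<n] = choice_extend \<tau> w k"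
    by (rule nth_equalityI) (auto simp: n choice_seq_nth)
  moreover have "choice_seq \<tau> w n = choice_extend \<tau> w (Suc k) ! n"
    by (rule choice_seq_nth) (simp add: n)
  ultimately show ?thesis by (simp add: n nth_append)
qed

text \<open>As \<delta> decreases strictly, a ball of radius \<open>\<delta> N\<close> lies in a
  cylinder of length \<open>N\<close>, on which \<open>f\<close> is constant.\<close>

lemma continuous_map_locally_constant:
  fixes f :: "(nat \<Rightarrow> letter) \<Rightarrow> complex"
  assumes pos: "\<And>n. 0 < \<delta> n" and decr: "\<And>m n. m < n \<Longrightarrow> \<delta> n < \<delta> m"
    and f: "\<And>\<xi> \<eta>. (\<forall>j<N. \<xi> j = \<eta> j) \<Longrightarrow> f \<xi> = f \<eta>"
  shows "continuous_map (sturmian_topology \<delta> \<theta>) euclidean f"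
proof -
  interpret Metric_space "sturmian_subshift \<theta>" "prefix_dist \<delta>"
    using pos decr by (rule Metric_space_prefix_dist)
  have agree: "\<forall>j<N. \<xi> j = \<eta> j" if d: "prefix_dist \<delta> \<xi> \<eta> < \<delta> N" for \<xi> \<eta> :: "nat \<Rightarrow> letter"
  proof (rule ccontr)
    assume "\<not> ?thesis"
    then obtain j where j: "j < N" "\<xi> j \<noteq> \<eta> j" by blast
    then have "(LEAST n. \<xi> n \<noteq> \<eta> n) < N" using Least_le[of "\<lambda>n. \<xi> n \<noteq> \<eta> n" j] by simp
    then have "\<delta> N < prefix_dist \<delta> \<xi> \<eta>" using j decr by (auto simp: prefix_dist_def)
    then show False using d by simp
  qed
  show ?thesis
    unfolding sturmian_topology_def continuous_map_def
  proof (intro conjI allI impI)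
    fix U :: "complex set"
    show "openin mtopology {x \<in> topspace mtopology. f x \<in> U}"
      unfolding openin_mtopology
    proof (intro conjI allI impI)
      fix x assume x: "x \<in> {x \<in> topspace mtopology. f x \<in> U}"
      have "mball x (\<delta> N) \<subseteq> {x \<in> topspace mtopology. f x \<in> U}"
        using x f[OF agree] by (auto simp: in_mball)
      then show "\<exists>r>0. mball x r \<subseteq> {x \<in> topspace mtopology. f x \<in> U}" using pos by blast
    qed auto
  qed auto
qed

text \<open>Only boundedly many of the cylinders around \<open>x\<close> contain \<open>y\<close>,
  so the test functions separate the two by the sum of \<delta> over \<open>F\<close> up to a
  constant.\<close>

lemma spectral_dist_infinite:
  fixes \<delta> :: "nat \<Rightarrow> real" and x y :: "nat \<Rightarrow> letter"
  assumes pos: "\<And>n. 0 < \<delta> n" and decr: "\<And>m n. m < n \<Longrightarrow> \<delta> n < \<delta> m"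
    and neq: "x \<noteq> y"
    and dev: "\<And>B. \<exists>F. finite F \<and> (\<forall>n\<in>F. \<tau> (map x [0..<n]) \<noteq> x n) \<and> B \<le> sum \<delta> F"
  shows "spectral_dist \<delta> \<theta> \<tau> x y = \<infinity>"
proof -
  define S where "S = {n. \<tau> (map x [0..<n]) \<noteq> x n}"
  \<comment> \<open>Index \<open>i\<close> is included, so that deviating at \<open>i\<close> means
    leaving the cylinder.\<close>
  define A where "A i \<xi> \<longleftrightarrow> (\<forall>j\<le>i. \<xi> j = x j)" for i and \<xi> :: "nat \<Rightarrow> letter"
  define g where "g F \<xi> = (\<Sum>i\<in>F. if A i \<xi> then \<delta> i else 0)" for F \<xi>
  have nn: "0 \<le> \<delta> n" for n using pos[of n] by simp
  \<comment> \<open>A choice sequence that agrees with \<open>x\<close> up to a deviation index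
    beyond \<open>w\<close> must there take the letter chosen by \<tau>, which is not that of
    \<open>x\<close>.\<close>
  have not_A: "\<not> A i (choice_seq \<tau> w)" if "i \<in> S" "length w \<le> i" for i w
  proof
    assume a: "A i (choice_seq \<tau> w)"
    then have "map (choice_seq \<tau> w) [0..<i] = map x [0..<i]" by (auto simp: A_def)
    then have "choice_seq \<tau> w i = \<tau> (map x [0..<i])" using choice_seq_chosen[OF that(2), of \<tau>] by (simp only:)
    then show False using a that(1) by (auto simp: S_def A_def)
  qed
  have edge: "\<bar>g F (choice_seq \<tau> u) - g F (choice_seq \<tau> v)\<bar> \<le> edge_length \<delta> (u, v)"
    if F: "finite F" "F \<subseteq> S" and uv: "(u, v) \<in> edges \<theta>" for F u v
  proof -
    obtain n where n: "length u = n + 1" "length v = n + 1" "take n u = take n v"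
      using uv by (auto simp: edges_def)
    let ?\<xi> = "choice_seq \<tau> u" and ?\<eta> = "choice_seq \<tau> v"
    have eq: "?\<xi> j = ?\<eta> j" if "j < n" for j
      using n that by (simp add: choice_seq_prefix) (metis nth_take)
    \<comment> \<open>Before \<open>n\<close> the common prefix makes the terms cancel; after
      \<open>n\<close> both vanish by \<open>not_A\<close>. What remains at \<open>n\<close> is at
      most \<open>\<delta> n\<close>, the length of the edge.\<close>
    have "(if A i ?\<xi> then \<delta> i else 0) - (if A i ?\<eta> then \<delta> i else 0) =
        (if i = n then (if A n ?\<xi> then \<delta> n else 0) - (if A n ?\<eta> then \<delta> n else 0) else 0)"
      if "i \<in> F" for i
    proof (cases i n rule: linorder_cases)
      case less
      then have "A i ?\<xi> \<longleftrightarrow> A i ?\<eta>" using eq by (auto simp: A_def)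
      then show ?thesis using less by simp
    next
      case greater
      then show ?thesis using not_A[of i u] not_A[of i v] n F(2) that by auto
    qed simp
    then have "g F ?\<xi> - g F ?\<eta> =
        (\<Sum>i\<in>F. if i = n then (if A n ?\<xi> then \<delta> n else 0) - (if A n ?\<eta> then \<delta> n else 0) else 0)"
      unfolding g_def sum_subtractf[symmetric] by (intro sum.cong) auto
    then show ?thesis using F(1) n nn[of n] by (auto simp: edge_length_def sum.delta)
  qed
  obtain k where k: "x k \<noteq> y k" using neq by (auto simp: fun_eq_iff)
  have big: "ennreal B \<le> spectral_dist \<delta> \<theta> \<tau> x y" for B
  proof -
    \<comment> \<open>The surplus over \<open>B\<close> compensates for the cylinders of index below
      \<open>k\<close>, the only ones that can contain \<open>y\<close>.\<close>
    obtain F where F: "finite F" "\<forall>n\<in>F. \<tau> (map x [0..<n]) \<noteq> x n" "B + sum \<delta> {..<k} \<le> sum \<delta> F"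
      using dev by blast
    have FS: "F \<subseteq> S" using F(2) by (auto simp: S_def)
    let ?f = "\<lambda>\<xi>. complex_of_real (g F \<xi>)"
    obtain N where N: "\<forall>i\<in>F. i < N" using F(1) finite_nat_set_iff_bounded by blast
    have "continuous_map (sturmian_topology \<delta> \<theta>) euclidean ?f"
    proof (rule continuous_map_locally_constant[OF pos decr])
      fix \<xi> \<eta> :: "nat \<Rightarrow> letter" assume "\<forall>j<N. \<xi> j = \<eta> j"
      then have "A i \<xi> \<longleftrightarrow> A i \<eta>" if "i \<in> F" for i
        using N that by (auto simp: A_def)
      then show "?f \<xi> = ?f \<eta>" by (simp add: g_def)
    qed
    moreover have "commutator_norm_le_1 \<delta> \<theta> \<tau> ?f"
      unfolding commutator_norm_le_1_iff[OF pos]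
      using edge[OF F(1) FS] by (auto simp flip: of_real_diff)
    ultimately have "ennreal (cmod (?f x - ?f y)) \<le> spectral_dist \<delta> \<theta> \<tau> x y"
      unfolding spectral_dist_def by (intro SUP_upper) simp
    moreover have "B \<le> cmod (?f x - ?f y)"
    proof -
      have "g F x = sum \<delta> F" by (simp add: g_def A_def)
      moreover have "g F y \<le> sum \<delta> {..<k}"
      proof -
        have "g F y \<le> (\<Sum>i\<in>F. if i < k then \<delta> i else 0)"
          unfolding g_def by (intro sum_mono) (use k nn in \<open>auto simp: A_def not_less\<close>)
        also have "\<dots> = sum \<delta> (F \<inter> {..<k})"
          using F(1) by (simp add: sum.inter_restrict)
        also have "\<dots> \<le> sum \<delta> {..<k}" using nn by (intro sum_mono2) auto
        finally show ?thesis .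
      qed
      ultimately have "B \<le> g F x - g F y" using F(3) by linarith
      also have "\<dots> \<le> cmod (?f x - ?f y)" by (simp flip: of_real_diff)
      finally show ?thesis .
    qed
    ultimately show ?thesis using ennreal_leI order_trans by blast
  qed
  show ?thesis
  proof (rule ccontr)
    assume "spectral_dist \<delta> \<theta> \<tau> x y \<noteq> \<infinity>"
    then obtain r where "0 \<le> r" "spectral_dist \<delta> \<theta> \<tau> x y = ennreal r"
      by (cases "spectral_dist \<delta> \<theta> \<tau> x y") auto
    then show False using big[of "r + 1"] by (simp add: ennreal_le_iff)
  qed
qed

theorem theorem4p14:
  fixes \<delta> :: "nat \<Rightarrow> real"
  assumes "\<And>n. 0 < \<delta> n"
    and "\<And>m n. m < n \<Longrightarrow> \<delta> n < \<delta> m"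
    and "\<delta> \<longlonglongrightarrow> 0"
    and "\<not> summable \<delta>"
  shows "\<exists>\<theta>::real. 0 < \<theta> \<and> \<theta> < 1 \<and> \<theta> \<notin> \<rat> \<and>
           \<not> continuous_dist \<delta> \<theta> (sup_spectral_dist \<delta> \<theta>) \<and>
           (\<exists>\<tau>. choice_function \<theta> \<tau> \<and> \<not> continuous_dist \<delta> \<theta> (spectral_dist \<delta> \<theta> \<tau>))"
proof -
  note pos = assms(1) and decr = assms(2)
  obtain \<alpha> :: real where \<alpha>: "0 < \<alpha>" "\<alpha> < 1/2" "\<alpha> \<notin> \<rat>"
    and many: "\<And>B. \<exists>F. finite F \<and> (\<forall>n\<in>F. record_min \<alpha> (Suc n)) \<and> B \<le> sum \<delta> F"
    using ex_slope_with_many_records[OF pos decr assms(4), of 0 "1/2"] by auto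
  \<comment> \<open>Inverse of \<open>\<alpha> = \<theta> / (1 + \<theta>)\<close>; slopes in
    \<open>(0, 1)\<close> correspond to \<alpha> in \<open>(0, 1/2)\<close>.\<close>
  define \<theta> where "\<theta> = \<alpha> / (1 - \<alpha>)"
  have \<theta>: "0 < \<theta>" "\<theta> < 1" using \<alpha> by (auto simp: \<theta>_def field_simps)
  have irr: "\<theta> \<notin> \<rat>"
  proof
    assume "\<theta> \<in> \<rat>"
    then have "\<theta> / (1 + \<theta>) \<in> \<rat>" by simp
    moreover have "\<theta> / (1 + \<theta>) = \<alpha>" using \<alpha> by (simp add: \<theta>_def field_simps)
    ultimately show False using \<alpha>(3) by simp
  qed
  define x where "x = coding \<alpha> 0"
  \<comment> \<open>The shift of \<open>x\<close> serves as a second point; the two differ in the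
    first letter because \<open>\<alpha> < 1 - \<alpha>\<close>.\<close>
  define y where "y n = x (Suc n)" for n
  have x: "x \<in> sturmian_subshift \<theta>" unfolding x_def \<theta>_def by (rule coding_0_in_subshift[OF \<alpha>])
  have y: "y \<in> sturmian_subshift \<theta>"
    unfolding sturmian_subshift_def mem_Collect_eq
  proof (intro allI)
    fix i n
    have "map y [i..<i + n] = map x [Suc i..<Suc i + n]"
      by (rule nth_equalityI) (auto simp: y_def simp del: upt_Suc)
    moreover have "map x [Suc i..<Suc i + n] \<in> sturmian_language \<theta>"
      using x unfolding sturmian_subshift_def by blast
    ultimately show "map y [i..<i + n] \<in> sturmian_language \<theta>" by (simp only:)
  qed
  have "x 0 = Vert" using \<alpha> by (simp add: x_def coding_def)
  moreover have "y 0 = Horiz"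
    using frac_uminus_multiple[OF \<alpha>(3), of 1] \<alpha> by (simp add: x_def y_def coding_def)
  ultimately have neq: "x \<noteq> y" by auto
  \<comment> \<open>Deviate from the letter of \<open>x\<close> at this position whenever the
    language allows it, and take any admissible letter otherwise.\<close>
  define \<tau> where "\<tau> w = (SOME a. w @ [a] \<in> sturmian_language \<theta> \<and>
      ((\<exists>b. b \<noteq> x (length w) \<and> w @ [b] \<in> sturmian_language \<theta>) \<longrightarrow> a \<noteq> x (length w)))" for w
  have \<tau>: "w @ [\<tau> w] \<in> sturmian_language \<theta> \<and>
      ((\<exists>b. b \<noteq> x (length w) \<and> w @ [b] \<in> sturmian_language \<theta>) \<longrightarrow> \<tau> w \<noteq> x (length w))"
    if "\<exists>a. w @ [a] \<in> sturmian_language \<theta>" for w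
    unfolding \<tau>_def by (rule someI_ex) (use that in blast)
  have choice: "choice_function \<theta> \<tau>"
    unfolding choice_function_def using \<tau> sturmian_language_extend[OF \<theta>] by blast
  have "\<tau> (map x [0..<n]) \<noteq> x n" if rec: "record_min \<alpha> (Suc n)" for n
  proof -
    obtain a where "a \<noteq> x n" "map x [0..<n] @ [a] \<in> sturmian_language \<theta>"
      using right_special_prefix[OF \<alpha> rec] unfolding x_def \<theta>_def by blast
    then show ?thesis using \<tau>[of "map x [0..<n]"] by auto
  qed
  then have dev: "\<exists>F. finite F \<and> (\<forall>n\<in>F. \<tau> (map x [0..<n]) \<noteq> x n) \<and> B \<le> sum \<delta> F" for B
    using many[of B] by blast
  have inf: "spectral_dist \<delta> \<theta> \<tau> x y = \<infinity>"
    by (rule spectral_dist_infinite[OF pos decr neq dev])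
  have "spectral_dist \<delta> \<theta> \<tau> x y \<le> sup_spectral_dist \<delta> \<theta> x y"
    unfolding sup_spectral_dist_def using choice by (intro SUP_upper) simp
  then have "sup_spectral_dist \<delta> \<theta> x y = \<infinity>" using inf by (simp add: top_unique)
  then have "\<not> continuous_dist \<delta> \<theta> (sup_spectral_dist \<delta> \<theta>)"
    using x y by (auto simp: continuous_dist_def)
  moreover have "\<not> continuous_dist \<delta> \<theta> (spectral_dist \<delta> \<theta> \<tau>)"
    using x y inf by (auto simp: continuous_dist_def)
  ultimately show ?thesis using \<theta> irr choice by blast
qed

end
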